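(* Let $d$ be a positive integer. For every $v\in\{0,1\}^d\setminus\{0\}$, the graph of the revlex-initial 0/1-polytope $P^{\prec v}$ has edge expansion at least one.
   Context: Vectors $x\in\mathbb{R}^d$ have components $x_0,x_1,\dots,x_{d-1}$. For distinct $x,y\in\{0,1\}^d$, $x\prec y$ (reverse-lexicographically smaller) means $x_m<y_m$ for $m=\max\{i: x_i\neq y_i\}$. For $v\in\{0,1\}^d$, $P^{\prec v}:=\operatorname{conv}\{x\in\{0,1\}^d : x\prec v\}$ (a revlex-initial 0/1-polytope). The graph of a polytope has as nodes the vertices of the polytope and as edges its one-dimensional faces. The edge expansion of a graph $G=(V,E)$ is $$\min\left\{\frac{|\delta(T)|}{|T|} : T\subset V,\ 0<|T|\le\frac{|V|}{2}\right\},$$ where $\delta(T)$ denotes the set of all edges with one end node in $T$ and the other one in $V\setminus T$. When no such $T$ exists (a graph with one node), the minimum is taken to be $+\infty$, so that "edge expansion at least one" means $|\delta(T)|\ge|T|$ for all such $T$. *)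

theory Defs
  imports "HOL-Analysis.Analysis"
begin

(* A vector of R^d has type real^'n with d = CARD('n), which is automatically positive. The linear
   order on the finite index type 'n plays the role of the order on {0, ..., d - 1}; every finite
   linear order of size d is uniquely isomorphic to that one. *)

definition zero_one_vectors :: "(real ^ 'n) set" where
  "zero_one_vectors = {x. \<forall>i. x $ i \<in> {0, 1}}"

definition revlex_less :: "real ^ 'n::{finite,linorder} \<Rightarrow> real ^ 'n::{finite,linorder} \<Rightarrow> bool" where
  "revlex_less x y \<longleftrightarrow> x \<noteq> y \<and> (let m = Max {i. x $ i \<noteq> y $ i} in x $ m < y $ m)"

definition revlex_polytope :: "real ^ 'n::{finite,linorder} \<Rightarrow> (real ^ 'n::{finite,linorder}) set" where
  "revlex_polytope v = convex hull {x \<in> zero_one_vectors. revlex_less x v}"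

definition polytope_nodes :: "'a::euclidean_space set \<Rightarrow> 'a set" where
  "polytope_nodes P = {x. x extreme_point_of P}"

(* Each one-dimensional face is recorded as the two-element set of its end nodes; for a polytope
   this loses nothing, as a bounded edge is the segment joining its two vertices. *)
definition polytope_links :: "'a::euclidean_space set \<Rightarrow> 'a set set" where
  "polytope_links P = (\<lambda>e. {x. x extreme_point_of e}) ` {e. e edge_of P}"

definition edge_cut :: "'a set \<Rightarrow> 'a set set \<Rightarrow> 'a set \<Rightarrow> 'a set set" where
  "edge_cut V E T = {e \<in> E. \<exists>x\<in>T. \<exists>y\<in>V - T. e = {x, y}}"

(* For finite V the infimum ranges over a finite family, hence is a minimum; if the family is
   empty it is the top element, i.e. infinity. *)
definition edge_expansion :: "'a set \<Rightarrow> 'a set set \<Rightarrow> ereal" where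
  "edge_expansion V E =
     (INF T \<in> {T. T \<subset> V \<and> 0 < card T \<and> real (card T) \<le> real (card V) / 2}.
        ereal (real (card (edge_cut V E T)) / real (card T)))"

end

theory Submission
  imports Defs
begin

text \<open>
  A vertex of the polytope is the indicator vector of a set of coordinates, and the vertices
  together form an initial segment \<open>F\<close> of the colexicographic order on sets. Every 0/1 vector in
  such a polytope is a vertex because it is one of the unit cube, and two vertices that differ in
  a single coordinate are joined by an edge because they are so in the cube
  (\<open>cube_edge_in_polytope_links\<close>). The polytope may have further edges, but these cube edges
  already give the expansion: for every \<open>T \<subseteq> F\<close> the cube edges leaving \<open>T\<close> within \<open>F\<close> number
  at least \<open>min |T| |F - T|\<close> (\<open>card_cube_cut_ge\<close>).

  This bound is proved by induction on the number of coordinates, splitting off the \<^emph>\<open>smallest\<close>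
  one, \<open>m\<close>. Let \<open>F0\<close> be the members of \<open>F\<close> avoiding \<open>m\<close>, and \<open>F1\<close> the members containing \<open>m\<close>,
  with \<open>m\<close> removed. Both are initial segments again. As \<open>m\<close> is the least significant coordinate,
  \<open>F1\<close> arises from \<open>F0\<close> by deleting at most the last element: this is the numerical fact that
  below \<open>n\<close> there are as many odd numbers as even ones, up to one. So \<open>F0\<close> and \<open>F1\<close> are almost
  equal in size, and almost perfectly matched by the cube edges in direction \<open>m\<close>.

  Let \<open>T0\<close>, \<open>T1\<close> be the two parts of \<open>T\<close>. If both are at most half of \<open>F0\<close> and \<open>F1\<close>, the
  induction hypotheses add up to \<open>|T0| + |T1| = |T|\<close>; if both are at least half, the same holds for
  the complement. If \<open>T0\<close> is the large part and \<open>T1\<close> the small one, there are at least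
  \<open>|F0 - T0| + |T1|\<close> edges inside the two layers and at least \<open>|T0| - |T1| - |F0 - F1|\<close> between
  them, so at least \<open>|F0| - |F0 - F1| = |F1|\<close> in total, and \<open>|F1|\<close> is half of \<open>|F|\<close> rounded down.
  In the opposite mixed case the same count gives \<open>|F1|\<close>.
\<close>

section \<open>Initial segments of the colexicographic order\<close>

definition colex_less :: "'a::linorder set \<Rightarrow> 'a set \<Rightarrow> bool" where
  "colex_less A B \<longleftrightarrow> (\<exists>m. m \<in> B \<and> m \<notin> A \<and> (\<forall>j>m. j \<in> A \<longleftrightarrow> j \<in> B))"

definition colex_initial :: "'a::linorder set \<Rightarrow> 'a set set \<Rightarrow> bool" where
  "colex_initial I F \<longleftrightarrow> F \<subseteq> Pow I \<and> (\<forall>B\<in>F. \<forall>A\<subseteq>I. colex_less A B \<longrightarrow> A \<in> F)"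

lemma colex_initialD:
  assumes "colex_initial I F" "B \<in> F" "A \<subseteq> I" "colex_less A B"
  shows "A \<in> F"
  using assms by (simp add: colex_initial_def)

lemma colex_initial_subset: "colex_initial I F \<Longrightarrow> A \<in> F \<Longrightarrow> A \<subseteq> I"
  by (auto simp: colex_initial_def)

lemma colex_less_trans:
  assumes "colex_less A B" "colex_less B C"
  shows "colex_less A C"
proof -
  obtain m n where m: "m \<in> B" "m \<notin> A" "\<forall>j>m. j \<in> A \<longleftrightarrow> j \<in> B"
    and n: "n \<in> C" "n \<notin> B" "\<forall>j>n. j \<in> B \<longleftrightarrow> j \<in> C"
    using assms unfolding colex_less_def by blast
  have "m < n \<or> n < m" using m n by (metis linorder_less_linear)
  then have "max m n \<in> C \<and> max m n \<notin> A \<and> (\<forall>j>max m n. j \<in> A \<longleftrightarrow> j \<in> C)"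
    using m n by (auto simp: max_def)
  then show ?thesis unfolding colex_less_def by blast
qed

text \<open>
  The existential definition serves transitivity and the induction; this form connects to
  \<^const>\<open>revlex_less\<close>, which compares two vectors at the largest coordinate where they differ.
\<close>
lemma colex_less_Max:
  assumes "finite (sym_diff A B)"
  shows "colex_less A B \<longleftrightarrow> A \<noteq> B \<and> Max (sym_diff A B) \<in> B"
proof
  assume "colex_less A B"
  then obtain m where m: "m \<in> B" "m \<notin> A" "\<forall>j>m. j \<in> A \<longleftrightarrow> j \<in> B"
    unfolding colex_less_def by blast
  have "Max (sym_diff A B) = m"
    by (rule Max_eqI) (use assms m leI in auto)
  then show "A \<noteq> B \<and> Max (sym_diff A B) \<in> B" using m by auto
next
  assume *: "A \<noteq> B \<and> Max (sym_diff A B) \<in> B"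
  then have ne: "sym_diff A B \<noteq> {}" by blast
  have "Max (sym_diff A B) \<notin> A" using Max_in[OF assms ne] * by blast
  moreover have "j \<in> A \<longleftrightarrow> j \<in> B" if "j > Max (sym_diff A B)" for j
    using Max_ge[OF assms, of j] that by fastforce
  ultimately show "colex_less A B" using * unfolding colex_less_def by blast
qed

lemma colex_less_total:
  assumes "finite A" "finite B" "A \<noteq> B"
  shows "colex_less A B \<or> colex_less B A"
proof -
  have fin: "finite (sym_diff A B)" and ne: "sym_diff A B \<noteq> {}" using assms by auto
  have "sym_diff B A = sym_diff A B" by blast
  then show ?thesis
    using Max_in[OF fin ne] assms fin by (auto simp: colex_less_Max)
qed

section \<open>Edge expansion of initial segments in the cube graph\<close>

text \<open>
  Within \<open>F\<close>, the cube edge joining \<open>A\<close> and \<open>insert i A\<close> is recorded once, as its lower end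
  together with its direction.
\<close>
definition cube_cut :: "'a set set \<Rightarrow> 'a set set \<Rightarrow> ('a set \<times> 'a) set" where
  "cube_cut F T = {(A, i). i \<notin> A \<and> A \<in> F \<and> insert i A \<in> F \<and> (A \<in> T \<longleftrightarrow> insert i A \<notin> T)}"

lemma finite_cube_cut:
  assumes "finite I" "F \<subseteq> Pow I"
  shows "finite (cube_cut F T)"
  by (rule finite_subset[of _ "Pow I \<times> I"]) (use assms in \<open>auto simp: cube_cut_def\<close>)

text \<open>
  The two layers of a family in direction \<open>m\<close>, both as families of sets avoiding \<open>m\<close>; the names
  are those used for simplicial complexes.
\<close>
definition deletion :: "'a \<Rightarrow> 'a set set \<Rightarrow> 'a set set" where
  "deletion m F = {A \<in> F. m \<notin> A}"

definition link :: "'a \<Rightarrow> 'a set set \<Rightarrow> 'a set set" where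
  "link m F = {A. m \<notin> A \<and> insert m A \<in> F}"

lemma insert_image_link: "insert m ` link m F = {A \<in> F. m \<in> A}"
proof
  show "{A \<in> F. m \<in> A} \<subseteq> insert m ` link m F"
  proof
    fix A assume "A \<in> {A \<in> F. m \<in> A}"
    then have "A = insert m (A - {m})" "A - {m} \<in> link m F"
      by (auto simp: link_def insert_absorb)
    then show "A \<in> insert m ` link m F" by blast
  qed
qed (auto simp: link_def)

lemma inj_on_insert_link: "inj_on (insert m) (link m F)"
  by (rule inj_onI) (simp add: link_def insert_ident)

lemma finite_deletion_link:
  assumes "finite F"
  shows "finite (deletion m F)" "finite (link m F)"
proof -
  show "finite (deletion m F)" using assms by (simp add: deletion_def)
  have "finite (insert m ` link m F)" using assms by (simp add: insert_image_link)
  then show "finite (link m F)" using inj_on_insert_link by (rule finite_imageD)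
qed

lemma card_deletion_link:
  assumes "finite F"
  shows "card F = card (deletion m F) + card (link m F)"
proof -
  have F: "deletion m F \<union> insert m ` link m F = F"
    by (auto simp: insert_image_link deletion_def)
  have "card (deletion m F \<union> insert m ` link m F) = card (deletion m F) + card (insert m ` link m F)"
    by (rule card_Un_disjoint)
      (use assms in \<open>auto simp: finite_deletion_link deletion_def\<close>)
  then show ?thesis unfolding F by (simp add: card_image inj_on_insert_link)
qed

lemma colex_initial_deletion:
  assumes "colex_initial (insert m I) F" "m \<notin> I"
  shows "colex_initial I (deletion m F)"
  unfolding colex_initial_def
proof (intro conjI ballI allI impI)
  show "deletion m F \<subseteq> Pow I" using assms by (auto simp: colex_initial_def deletion_def)
next
  fix A B assume *: "B \<in> deletion m F" "A \<subseteq> I" "colex_less A B"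
  have "B \<in> F" using *(1) by (simp add: deletion_def)
  moreover have "A \<subseteq> insert m I" using *(2) by (rule subset_insertI2)
  ultimately have "A \<in> F" using colex_initialD[OF assms(1)] *(3) by simp
  moreover have "m \<notin> A" using *(2) assms(2) by (rule contra_subsetD)
  ultimately show "A \<in> deletion m F" by (simp add: deletion_def)
qed

lemma colex_initial_link:
  assumes "colex_initial (insert m I) F" "m \<notin> I"
  shows "colex_initial I (link m F)"
  unfolding colex_initial_def
proof (intro conjI ballI allI impI)
  show "link m F \<subseteq> Pow I" using assms by (auto simp: colex_initial_def link_def)
next
  fix A B assume *: "B \<in> link m F" "A \<subseteq> I" "colex_less A B"
  have mA: "m \<notin> A" using *(2) assms(2) by (rule contra_subsetD)
  obtain k where k: "k \<in> B" "k \<notin> A" "\<forall>j>k. j \<in> A \<longleftrightarrow> j \<in> B"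
    using *(3) unfolding colex_less_def by blast
  have "k \<noteq> m" using k(1) *(1) by (auto simp: link_def)
  then have "colex_less (insert m A) (insert m B)"
    unfolding colex_less_def using k by (intro exI[of _ k]) auto
  moreover have "insert m B \<in> F" using *(1) by (simp add: link_def)
  moreover have "insert m A \<subseteq> insert m I" using *(2) by (rule insert_mono)
  ultimately have "insert m A \<in> F" using colex_initialD[OF assms(1)] by simp
  then show "A \<in> link m F" using mA by (simp add: link_def)
qed

text \<open>Removing an element makes a set colexicographically smaller.\<close>
lemma link_subset_deletion:
  assumes "colex_initial (insert m I) F"
  shows "link m F \<subseteq> deletion m F"
proof
  fix A assume A: "A \<in> link m F"
  then have m: "m \<notin> A" "insert m A \<in> F" by (auto simp: link_def)
  have "colex_less A (insert m A)"
    unfolding colex_less_def using m(1) by (intro exI[of _ m]) auto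
  moreover have "A \<subseteq> insert m I" using colex_initial_subset[OF assms m(2)] by simp
  ultimately have "A \<in> F" using colex_initialD[OF assms m(2)] by simp
  then show "A \<in> deletion m F" using m(1) by (simp add: deletion_def)
qed

text \<open>
  If \<open>A\<close> precedes \<open>B\<close> in the layer avoiding \<open>m\<close>, they are told apart by a coordinate above \<open>m\<close>,
  so \<open>insert m A\<close> still precedes \<open>B\<close> and therefore belongs to \<open>F\<close>. Hence only the last element of
  this layer can lack its partner in direction \<open>m\<close>.
\<close>
lemma card_deletion_diff_link:
  assumes F: "colex_initial (insert m I) F" and fin: "finite I" and min: "\<forall>i\<in>I. m < i"
  shows "card (deletion m F - link m F) \<le> 1"
proof -
  have no: "\<not> colex_less A B"
    if A: "A \<in> deletion m F - link m F" and B: "B \<in> deletion m F - link m F" for A B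
  proof
    assume "colex_less A B"
    then obtain k where k: "k \<in> B" "k \<notin> A" "\<forall>j>k. j \<in> A \<longleftrightarrow> j \<in> B"
      unfolding colex_less_def by blast
    have B': "B \<in> F" "m \<notin> B" and A': "A \<in> F" "m \<notin> A"
      using A B by (auto simp: deletion_def)
    have "k \<noteq> m" using k(1) B'(2) by auto
    then have "m < k" using k(1) colex_initial_subset[OF F B'(1)] min by auto
    then have "colex_less (insert m A) B"
      unfolding colex_less_def using k by (intro exI[of _ k]) auto
    moreover have "insert m A \<subseteq> insert m I" using colex_initial_subset[OF F A'(1)] by simp
    ultimately have "insert m A \<in> F" using colex_initialD[OF F B'(1)] by simp
    then have "A \<in> link m F" using A'(2) by (simp add: link_def)
    then show False using A by simp
  qed
  have fins: "finite A" if "A \<in> deletion m F" for A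
    using colex_initial_subset[OF F, of A] that fin finite_subset[of A "insert m I"]
    by (simp add: deletion_def)
  have eq: "A = B"
    if "A \<in> deletion m F - link m F" "B \<in> deletion m F - link m F" for A B
    using no[OF that] no[OF that(2,1)] colex_less_total[of A B] fins that by blast
  show ?thesis
  proof (cases "deletion m F - link m F = {}")
    case False
    then obtain A where "A \<in> deletion m F - link m F" by blast
    then have "deletion m F - link m F = {A}" using eq by blast
    then show ?thesis by simp
  qed (metis card.empty zero_le)
qed

text \<open>
  The three summands count the cut edges inside the lower layer, inside the upper layer, and in
  direction \<open>m\<close>.
\<close>
lemma card_cube_cut_split:
  assumes "finite (cube_cut F T)" and sub: "link m F \<subseteq> deletion m F"
  shows "card (cube_cut (deletion m F) (deletion m T)) + card (cube_cut (link m F) (link m T))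
      + card {A \<in> link m F. A \<in> deletion m T \<longleftrightarrow> A \<notin> link m T} \<le> card (cube_cut F T)"
proof -
  let ?f = "\<lambda>(A, i). (insert m A, i)"
  define X where "X = cube_cut (deletion m F) (deletion m T)"
  define Y where "Y = ?f ` cube_cut (link m F) (link m T)"
  define Z where "Z = (\<lambda>A. (A, m)) ` {A \<in> link m F. A \<in> deletion m T \<longleftrightarrow> A \<notin> link m T}"
  have X: "X \<subseteq> cube_cut F T \<inter> {p. m \<notin> fst p \<and> snd p \<noteq> m}"
    by (auto simp: X_def cube_cut_def deletion_def)
  have Y: "Y \<subseteq> cube_cut F T \<inter> {p. m \<in> fst p \<and> snd p \<noteq> m}"
    by (auto simp: Y_def cube_cut_def link_def insert_commute)
  have Z: "Z \<subseteq> cube_cut F T \<inter> {p. snd p = m}"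
  proof
    fix p assume "p \<in> Z"
    then obtain A where A: "p = (A, m)" "A \<in> link m F" "A \<in> deletion m T \<longleftrightarrow> A \<notin> link m T"
      by (auto simp: Z_def)
    have "A \<in> F" using subsetD[OF sub A(2)] by (simp add: deletion_def)
    then show "p \<in> cube_cut F T \<inter> {p. snd p = m}"
      using A by (simp add: cube_cut_def link_def deletion_def)
  qed
  have disj: "X \<inter> Y = {}" "(X \<union> Y) \<inter> Z = {}" using X Y Z by blast+
  have subs: "X \<union> Y \<union> Z \<subseteq> cube_cut F T" using X Y Z by blast
  have fin: "finite X" "finite Y" "finite Z"
    using finite_subset[OF subs assms(1)] by simp_all
  have "inj_on ?f (cube_cut (link m F) (link m T))"
    by (rule inj_onI) (clarsimp simp: cube_cut_def link_def insert_ident)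
  then have "card Y = card (cube_cut (link m F) (link m T))"
    unfolding Y_def by (rule card_image)
  moreover have "card Z = card {A \<in> link m F. A \<in> deletion m T \<longleftrightarrow> A \<notin> link m T}"
    unfolding Z_def by (rule card_image) (simp add: inj_on_def)
  moreover have "card (X \<union> Y \<union> Z) = card X + card Y + card Z"
    using fin disj by (simp add: card_Un_disjoint)
  ultimately show ?thesis using card_mono[OF assms(1) subs] X_def by simp
qed

text \<open>
  The symmetric form of the bound, rather than one for small \<open>T\<close> only, is what the induction
  needs: either layer may be more than half filled by \<open>T\<close>.
\<close>
lemma card_cube_cut_ge:
  fixes I :: "'a::linorder set"
  assumes "finite I" "colex_initial I F" "T \<subseteq> F"
  shows "min (card T) (card F - card T) \<le> card (cube_cut F T)"
  using assms
proof (induction I arbitrary: F T rule: finite_linorder_min_induct)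
  case empty
  then have "F \<subseteq> {{}}" by (auto simp: colex_initial_def)
  then have "T = {} \<or> T = F" using empty by blast
  then show ?case by auto
next
  case (insert m I)
  have mI: "m \<notin> I" using insert.hyps by blast
  have FI: "F \<subseteq> Pow (insert m I)" using insert.prems(1) by (simp add: colex_initial_def)
  then have finF: "finite F" using insert.hyps(1) by (meson finite_Pow_iff finite_insert finite_subset)
  then have finT: "finite T" using insert.prems(2) finite_subset by blast
  let ?F0 = "deletion m F" and ?F1 = "link m F" and ?T0 = "deletion m T" and ?T1 = "link m T"
  let ?D = "{A \<in> ?F1. A \<in> ?T0 \<longleftrightarrow> A \<notin> ?T1}"
  have T0: "?T0 \<subseteq> ?F0" and T1: "?T1 \<subseteq> ?F1"
    using insert.prems(2) by (auto simp: deletion_def link_def)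
  note fin = finite_deletion_link[OF finF, of m] finite_deletion_link[OF finT, of m]
  have sub: "?F1 \<subseteq> ?F0" by (rule link_subset_deletion[OF insert.prems(1)])
  have IH0: "min (card ?T0) (card ?F0 - card ?T0) \<le> card (cube_cut ?F0 ?T0)"
    by (rule insert.IH[OF colex_initial_deletion[OF insert.prems(1) mI] T0])
  have IH1: "min (card ?T1) (card ?F1 - card ?T1) \<le> card (cube_cut ?F1 ?T1)"
    by (rule insert.IH[OF colex_initial_link[OF insert.prems(1) mI] T1])
  \<comment> \<open>The edges in direction \<open>m\<close> make up for the imbalance of the two parts, except at the one
    possible element without a partner.\<close>
  have "card ?T0 \<le> card (?D \<union> ?T1 \<union> (?F0 - ?F1))"
    by (rule card_mono) (use fin T0 in auto)
  also have "\<dots> \<le> card ?D + card ?T1 + card (?F0 - ?F1)"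
    by (meson add_le_mono card_Un_le le_refl le_trans)
  finally have D0: "card ?T0 \<le> card ?D + card ?T1 + card (?F0 - ?F1)" .
  have "card ?T1 \<le> card (?D \<union> ?T0)"
    by (rule card_mono) (use fin T1 in auto)
  then have D1: "card ?T1 \<le> card ?D + card ?T0"
    by (meson card_Un_le le_trans)
  have diff: "card ?F0 = card ?F1 + card (?F0 - ?F1)"
    using card_Diff_subset[OF fin(2) sub] card_mono[OF fin(1) sub] by linarith
  have le: "card ?T0 \<le> card ?F0" "card ?T1 \<le> card ?F1"
    using card_mono fin T0 T1 by auto
  have cut: "card (cube_cut ?F0 ?T0) + card (cube_cut ?F1 ?T1) + card ?D \<le> card (cube_cut F T)"
    by (rule card_cube_cut_split[OF finite_cube_cut[OF _ FI] sub]) (use insert.hyps in simp)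
  have one: "card (?F0 - ?F1) \<le> 1"
    using card_deletion_diff_link insert.prems(1) insert.hyps by blast
  show ?case
    using IH0 IH1 D0 D1 diff le cut one card_deletion_link[OF finF, of m] card_deletion_link[OF finT, of m]
    by linarith
qed

section \<open>Cube edges are edges of the polytope\<close>

definition indicator_vec :: "'n set \<Rightarrow> real ^ 'n" where
  "indicator_vec A = (\<chi> i. if i \<in> A then 1 else 0)"

lemma indicator_vec_eq_iff [simp]: "indicator_vec A = indicator_vec B \<longleftrightarrow> A = B"
  by (auto simp: indicator_vec_def vec_eq_iff split: if_splits)

lemma zero_one_vectors_eq: "zero_one_vectors = range indicator_vec"
proof -
  have "x = indicator_vec {i. x $ i = 1}" if "x \<in> zero_one_vectors" for x :: "real ^ 'a"
    using that by (auto simp: zero_one_vectors_def indicator_vec_def vec_eq_iff)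
  moreover have "indicator_vec A \<in> zero_one_vectors" for A :: "'a set"
    by (simp add: zero_one_vectors_def indicator_vec_def)
  ultimately show ?thesis by blast
qed

lemma revlex_less_indicator_vec:
  "revlex_less (indicator_vec A) (indicator_vec B) \<longleftrightarrow> colex_less A B"
proof -
  have diff: "{i. indicator_vec A $ i \<noteq> indicator_vec B $ i} = sym_diff A B"
    by (auto simp: indicator_vec_def)
  show ?thesis
  proof (cases "A = B")
    case False
    then have "Max (sym_diff A B) \<in> sym_diff A B" by (intro Max_in) auto
    then have "indicator_vec A $ Max (sym_diff A B) < indicator_vec B $ Max (sym_diff A B)
        \<longleftrightarrow> Max (sym_diff A B) \<in> B"
      by (auto simp: indicator_vec_def)
    then show ?thesis
      unfolding revlex_less_def diff Let_def by (simp add: colex_less_Max)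
  qed (simp add: revlex_less_def colex_less_def)
qed

definition subcube :: "'n set \<Rightarrow> 'n set \<Rightarrow> (real ^ 'n) set" where
  "subcube J A = {z \<in> cbox 0 1. \<forall>j\<in>J. z $ j = indicator_vec A $ j}"

text \<open>
  A coordinate of a point of the cube that equals 0 or 1 is extremal, so a segment of the cube
  with such a point in its interior is constant in that coordinate.
\<close>
lemma subcube_face_of_cbox: "subcube J A face_of cbox 0 (1 :: real ^ 'n)"
  unfolding face_of_def
proof (intro conjI ballI impI)
  show "subcube J A \<subseteq> cbox 0 1" by (auto simp: subcube_def)
  have "subcube J A = cbox 0 1 \<inter> (\<Inter>j\<in>J. {z. z $ j = indicator_vec A $ j})"
    by (auto simp: subcube_def)
  moreover have "convex {z :: real ^ 'n. z $ j = c}" for j c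
    using convex_hyperplane[of "axis j (1 :: real)" c] by (simp add: inner_axis')
  ultimately show "convex (subcube J A)"
    by (simp add: convex_Int convex_INT)
next
  fix a b x :: "real ^ 'n"
  assume ab: "a \<in> cbox 0 1" "b \<in> cbox 0 1" and x: "x \<in> subcube J A" "x \<in> open_segment a b"
  then obtain u where u: "0 < u" "u < 1" "x = (1 - u) *\<^sub>R a + u *\<^sub>R b"
    by (auto simp: in_segment)
  have "a $ j = indicator_vec A $ j \<and> b $ j = indicator_vec A $ j" if "j \<in> J" for j
  proof -
    have r: "0 \<le> a $ j" "a $ j \<le> 1" "0 \<le> b $ j" "b $ j \<le> 1"
      using ab by (auto simp: mem_box_cart)
    have e: "(1 - u) * a $ j + u * b $ j = indicator_vec A $ j"
      using x(1) u(3) that by (auto simp: subcube_def)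
    show ?thesis
    proof (cases "j \<in> A")
      case True
      have "(1 - u) * (1 - a $ j) + u * (1 - b $ j) = 0"
        using e True by (simp add: indicator_vec_def algebra_simps)
      then have "(1 - u) * (1 - a $ j) = 0 \<and> u * (1 - b $ j) = 0"
        using r u by (subst (asm) add_nonneg_eq_0_iff) auto
      then show ?thesis using True u by (simp add: indicator_vec_def)
    next
      case False
      then have "(1 - u) * a $ j + u * b $ j = 0" using e by (simp add: indicator_vec_def)
      then have "(1 - u) * a $ j = 0 \<and> u * b $ j = 0"
        using r u by (subst (asm) add_nonneg_eq_0_iff) auto
      then show ?thesis using False u by (simp add: indicator_vec_def)
    qed
  qed
  then show "a \<in> subcube J A" "b \<in> subcube J A" using ab by (auto simp: subcube_def)
qed

lemma subcube_UNIV: "subcube UNIV A = {indicator_vec A}"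
  by (auto simp: subcube_def vec_eq_iff mem_box_cart indicator_vec_def)

lemma subcube_edge:
  assumes "i \<notin> A"
  shows "subcube (- {i}) A = closed_segment (indicator_vec A) (indicator_vec (insert i A))"
proof (intro equalityI subsetI)
  fix z assume z: "z \<in> subcube (- {i}) A"
  have "z = (1 - z $ i) *\<^sub>R indicator_vec A + z $ i *\<^sub>R indicator_vec (insert i A)"
    unfolding vec_eq_iff
  proof
    fix j
    have "z $ j = indicator_vec A $ j" if "j \<noteq> i" using z that by (simp add: subcube_def)
    then show "z $ j = ((1 - z $ i) *\<^sub>R indicator_vec A + z $ i *\<^sub>R indicator_vec (insert i A)) $ j"
      using assms by (cases "j = i") (auto simp: indicator_vec_def)
  qed
  moreover have "0 \<le> z $ i" "z $ i \<le> 1" using z by (auto simp: subcube_def mem_box_cart)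
  ultimately show "z \<in> closed_segment (indicator_vec A) (indicator_vec (insert i A))"
    unfolding in_segment by blast
next
  fix z assume "z \<in> closed_segment (indicator_vec A) (indicator_vec (insert i A))"
  then show "z \<in> subcube (- {i}) A"
    by (auto simp: in_segment subcube_def indicator_vec_def mem_box_cart)
qed

lemma convex_hull_indicator_vec_subset: "convex hull (indicator_vec ` F) \<subseteq> cbox 0 1"
  by (rule hull_minimal) (auto simp: indicator_vec_def mem_box_cart)

text \<open>
  A face of the unit cube that lies in the smaller polytope is also a face of that polytope. Here
  this is used for vertices, and below for edges.
\<close>
lemma polytope_nodes_indicator_vec:
  "polytope_nodes (convex hull (indicator_vec ` F)) = indicator_vec ` F"
proof -
  have "indicator_vec A extreme_point_of convex hull (indicator_vec ` F)" if "A \<in> F" for A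
    unfolding face_of_singleton[symmetric]
    by (rule face_of_subset[OF subcube_face_of_cbox[of UNIV A, unfolded subcube_UNIV] _
        convex_hull_indicator_vec_subset])
      (use that in \<open>auto intro: hull_inc\<close>)
  then show ?thesis
    unfolding polytope_nodes_def using extreme_point_of_convex_hull by blast
qed

lemma cube_edge_in_polytope_links:
  assumes "i \<notin> A" "A \<in> F" "insert i A \<in> F"
  shows "{indicator_vec A, indicator_vec (insert i A)}
    \<in> polytope_links (convex hull (indicator_vec ` F))"
proof -
  let ?x = "indicator_vec A" and ?y = "indicator_vec (insert i A)"
  have ne: "?x \<noteq> ?y" using assms by auto
  have "closed_segment ?x ?y \<subseteq> convex hull (indicator_vec ` F)"
    unfolding segment_convex_hull by (rule hull_mono) (use assms in auto)
  then have "closed_segment ?x ?y face_of convex hull (indicator_vec ` F)"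
    using face_of_subset[OF subcube_face_of_cbox _ convex_hull_indicator_vec_subset]
      subcube_edge[OF assms(1)] by metis
  moreover have "aff_dim (closed_segment ?x ?y) = 1"
    using ne by (simp add: segment_convex_hull aff_dim_convex_hull aff_dim_2)
  ultimately have "closed_segment ?x ?y edge_of convex hull (indicator_vec ` F)"
    by (simp add: edge_of_def)
  moreover have "{z. z extreme_point_of closed_segment ?x ?y} = {?x, ?y}"
    by (auto simp: extreme_point_of_segment)
  ultimately show ?thesis unfolding polytope_links_def by blast
qed

lemma card_edge_cut_ge:
  fixes F :: "'n::finite set set"
  defines "P \<equiv> convex hull (indicator_vec ` F)"
  assumes "T \<subseteq> F"
  shows "card (cube_cut F T) \<le> card (edge_cut (polytope_nodes P) (polytope_links P) (indicator_vec ` T))"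
proof (rule card_inj_on_le)
  let ?f = "\<lambda>(A, i). {indicator_vec A, indicator_vec (insert i A)}"
  show "inj_on ?f (cube_cut F T)"
  proof (rule inj_onI, clarify)
    fix A i B j
    assume "(A, i) \<in> cube_cut F T" "(B, j) \<in> cube_cut F T"
    then have ij: "i \<notin> A" "j \<notin> B" by (simp_all add: cube_cut_def)
    assume "{indicator_vec A, indicator_vec (insert i A)}
      = {indicator_vec B, indicator_vec (insert j B)}"
    then consider "A = B" "insert i A = insert j B" | "A = insert j B" "insert i A = B"
      by (auto simp: doubleton_eq_iff)
    then show "A = B \<and> i = j"
    proof cases
      case 1
      then show ?thesis using ij by (metis insertE insertI1)
    next
      case 2
      then show ?thesis using ij by (metis insertCI)
    qed
  qed
  show "?f ` cube_cut F T \<subseteq> edge_cut (polytope_nodes P) (polytope_links P) (indicator_vec ` T)"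
  proof clarify
    fix A i assume "(A, i) \<in> cube_cut F T"
    then have *: "i \<notin> A" "A \<in> F" "insert i A \<in> F" "A \<in> T \<longleftrightarrow> insert i A \<notin> T"
      by (auto simp: cube_cut_def)
    have "\<exists>x\<in>indicator_vec ` T. \<exists>y\<in>indicator_vec ` F - indicator_vec ` T.
        {indicator_vec A, indicator_vec (insert i A)} = {x, y}"
    proof (cases "A \<in> T")
      case True
      show ?thesis
        by (intro bexI[of _ "indicator_vec A"] bexI[of _ "indicator_vec (insert i A)"])
          (use True * in auto)
    next
      case False
      show ?thesis
        by (intro bexI[of _ "indicator_vec (insert i A)"] bexI[of _ "indicator_vec A"])
          (use False * in auto)
    qed
    then show "{indicator_vec A, indicator_vec (insert i A)}
        \<in> edge_cut (polytope_nodes P) (polytope_links P) (indicator_vec ` T)"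
      using cube_edge_in_polytope_links[OF *(1-3)]
      unfolding edge_cut_def P_def polytope_nodes_indicator_vec by blast
  qed
  show "finite (edge_cut (polytope_nodes P) (polytope_links P) (indicator_vec ` T))"
    by (rule finite_subset[of _ "Pow (polytope_nodes P)"])
      (use assms in \<open>auto simp: edge_cut_def P_def polytope_nodes_indicator_vec\<close>)
qed

section \<open>Edge expansion of revlex-initial polytopes\<close>

theorem theorem5:
  fixes v :: "real ^ 'n::{finite,linorder}"
  assumes "v \<in> zero_one_vectors - {0}"
  shows "1 \<le> edge_expansion (polytope_nodes (revlex_polytope v)) (polytope_links (revlex_polytope v))"
proof -
  obtain W where W: "v = indicator_vec W" using assms by (auto simp: zero_one_vectors_eq)
  define F where "F = {A. colex_less A W}"
  have "{x \<in> zero_one_vectors. revlex_less x v} = indicator_vec ` F"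
    by (auto simp: zero_one_vectors_eq F_def W revlex_less_indicator_vec)
  then have P: "revlex_polytope v = convex hull (indicator_vec ` F)"
    by (simp add: revlex_polytope_def)
  have F: "colex_initial UNIV F"
    unfolding colex_initial_def F_def by (auto intro: colex_less_trans)
  show ?thesis
    unfolding edge_expansion_def
  proof (rule INF_greatest)
    fix S
    assume "S \<in> {T. T \<subset> polytope_nodes (revlex_polytope v) \<and> 0 < card T \<and>
      real (card T) \<le> real (card (polytope_nodes (revlex_polytope v))) / 2}"
    then have S: "S \<subset> polytope_nodes (revlex_polytope v)" "0 < card S"
      and half: "real (card S) \<le> real (card (polytope_nodes (revlex_polytope v))) / 2"
      by simp_all
    from S(1) obtain T where T: "S = indicator_vec ` T" "T \<subseteq> F"
      unfolding P polytope_nodes_indicator_vec by (meson psubset_imp_subset subset_imageE)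
    have inj: "inj_on indicator_vec X" for X :: "'n set set" by (simp add: inj_on_def)
    have "2 * card T \<le> card F"
      using half unfolding P polytope_nodes_indicator_vec T(1) card_image[OF inj] by linarith
    then have "card T \<le> card (cube_cut F T)"
      using card_cube_cut_ge[OF finite F T(2)] by linarith
    also have "\<dots> \<le> card (edge_cut (polytope_nodes (revlex_polytope v))
        (polytope_links (revlex_polytope v)) S)"
      unfolding P T(1) by (rule card_edge_cut_ge[OF T(2)])
    finally have "card S \<le> card (edge_cut (polytope_nodes (revlex_polytope v))
        (polytope_links (revlex_polytope v)) S)"
      by (simp add: T(1) card_image[OF inj])
    then show "1 \<le> ereal (real (card (edge_cut (polytope_nodes (revlex_polytope v))
        (polytope_links (revlex_polytope v)) S)) / real (card S))"
      using S(2) by (simp add: one_ereal_def)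
  qed
qed

end
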